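(* Given two $\mathbb{F}_0$-composable classes of filters $\mathbb{D}$ and $\mathbb{H}$, $$\operatorname{A}_{\mathbb{D}}=\operatorname{A}_{\mathbb{H}}\iff\widehat{\mathbb{H}}=\widehat{\mathbb{D}}.$$
   Context: Filters. For a set $X$, $\mathbb{F}X$ is the set of proper filters on $X$, ordered by inclusion ($\mathcal{F}\le\mathcal{G}$ iff $\mathcal{F}\subset\mathcal{G}$), and $\overline{\mathbb{F}X}=\mathbb{F}X\cup\{\mathcal{P}(X)\}$ also includes the degenerate filter. Two families $\mathcal{A},\mathcal{B}$ of subsets of $X$ mesh, written $\mathcal{A}\#\mathcal{B}$, if $A\cap B\neq\emptyset$ for all $A\in\mathcal{A}$, $B\in\mathcal{B}$. $\mathbb{U}(\mathcal{H})$ denotes the set of ultrafilters on $X$ that are finer than (contain) $\mathcal{H}$. For $x\in X$, $\{x\}^{\uparrow}$ is the principal ultrafilter of $x$. Classes of filters. A class of filters $\mathbb{D}$ assigns to each set $X$ a set $\mathbb{D}X$ of filters on $X$. $\mathbb{D}$ is $\mathbb{F}_0$-composable if $\mathbb{D}X\subset\overline{\mathbb{F}X}$ for every set $X$, and for all sets $X,Y$, every relation $R\subset X\times Y$ and every $\mathcal{D}\in\mathbb{D}X$, the filter on $Y$ generated by $\{R(D):D\in\mathcal{D}\}$ (where $R(D)=\{y:\exists x\in D,\ (x,y)\in R\}$) belongs to $\mathbb{D}Y$. Such classes are understood to contain all principal filters. Given a class $\mathbb{D}$, the class $\widehat{\mathbb{D}}$ is defined for each set $X$ by $$\widehat{\mathbb{D}}X=\{\mathcal{H}\in\mathbb{F}X:\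 \forall\,\mathcal{U}\in\mathbb{U}(\mathcal{H})\ \exists\,\mathcal{D}\in\mathbb{D}X:\ \mathcal{H}\le\mathcal{D}\le\mathcal{U}\}.$$ Equality of classes means equality on every set $X$. Convergences. A convergence $\xi$ on a set $X=|\xi|$ is a relation between points $x\in X$ and filters $\mathcal{F}\in\mathbb{F}X$, written $x\in\lim_{\xi}\mathcal{F}$, such that $x\in\lim_\xi\{x\}^{\uparrow}$ for all $x\in X$, and $\lim_\xi\mathcal{F}\subset\lim_\xi\mathcal{G}$ whenever $\mathcal{F}\le\mathcal{G}$. Put $\operatorname{adh}_\xi\mathcal{H}=\bigcup\{\lim_\xi\mathcal{G}:\mathcal{G}\in\mathbb{F}X,\ \mathcal{G}\ge\mathcal{H}\}$. For a class $\mathbb{D}$, $\operatorname{A}_{\mathbb{D}}\xi$ is the convergence on $|\xi|$ given by $\lim_{\operatorname{A}_{\mathbb{D}}\xi}\mathcal{F}=\bigcap\{\operatorname{adh}_\xi\mathcal{D}:\mathcal{D}\in\mathbb{D}|\xi|,\ \mathcal{D}\#\mathcal{F}\}$. $\operatorname{A}_{\mathbb{D}}=\operatorname{A}_{\mathbb{H}}$ means $\operatorname{A}_{\mathbb{D}}\xi=\operatorname{A}_{\mathbb{H}}\xi$ for every convergence $\xi$. *)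

theory Defs
  imports Main
begin

text \<open>
  Sets are the subsets \<open>X\<close> of an arbitrary type \<open>'a\<close>. A filter on \<open>X\<close>, degenerate or not,
  is a library filter \<open>F \<le> principal X\<close>; the corresponding family of subsets of \<open>X\<close> is
  \<open>members X F\<close>, and the degenerate filter is \<open>bot\<close>. The library order is reverse inclusion:
  \<open>G \<le> F\<close> says that \<open>G\<close> is finer than \<open>F\<close>.
\<close>

definition filters_on :: "'a set \<Rightarrow> 'a filter set" where
  "filters_on X = {F. F \<le> principal X}"

definition proper_filters_on :: "'a set \<Rightarrow> 'a filter set" where
  "proper_filters_on X = {F \<in> filters_on X. F \<noteq> bot}"

definition members :: "'a set \<Rightarrow> 'a filter \<Rightarrow> 'a set set" where
  "members X F = {A. A \<subseteq> X \<and> eventually (\<lambda>x. x \<in> A) F}"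

definition ultrafilters_on :: "'a set \<Rightarrow> 'a filter set" where
  "ultrafilters_on X =
     {U \<in> proper_filters_on X. \<forall>G \<in> proper_filters_on X. G \<le> U \<longrightarrow> G = U}"

definition ultrafilters_finer :: "'a set \<Rightarrow> 'a filter \<Rightarrow> 'a filter set" where
  "ultrafilters_finer X H = {U \<in> ultrafilters_on X. U \<le> H}"

definition mesh :: "'a set set \<Rightarrow> 'a set set \<Rightarrow> bool" where
  "mesh \<A> \<B> \<longleftrightarrow> (\<forall>A \<in> \<A>. \<forall>B \<in> \<B>. A \<inter> B \<noteq> {})"


type_synonym 'a filter_class = "'a set \<Rightarrow> 'a filter set"

text \<open>The infimum is the coarsest filter having all the sets \<open>R `` A\<close> as members.\<close>

definition image_filter :: "'a set \<Rightarrow> ('a \<times> 'a) set \<Rightarrow> 'a filter \<Rightarrow> 'a filter" where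
  "image_filter X R F = (INF A \<in> members X F. principal (R `` A))"

definition F0_composable :: "'a filter_class \<Rightarrow> bool" where
  "F0_composable \<D> \<longleftrightarrow>
     (\<forall>X. \<D> X \<subseteq> filters_on X) \<and>
     (\<forall>X A. A \<subseteq> X \<longrightarrow> principal A \<in> \<D> X) \<and>
     (\<forall>X Y R D. R \<subseteq> X \<times> Y \<longrightarrow> D \<in> \<D> X \<longrightarrow> image_filter X R D \<in> \<D> Y)"

definition hat :: "'a filter_class \<Rightarrow> 'a filter_class" where
  "hat \<D> X =
     {H \<in> proper_filters_on X. \<forall>U \<in> ultrafilters_finer X H. \<exists>D \<in> \<D> X. U \<le> D \<and> D \<le> H}"


text \<open>
  A convergence on \<open>X\<close> is the set of pairs \<open>(x, F)\<close> with \<open>x\<close> in the limit of \<open>F\<close>. As only points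
  of \<open>X\<close> and proper filters on \<open>X\<close> may occur, equality of convergences on \<open>X\<close> is set equality.
\<close>

definition lim_of :: "('a \<times> 'a filter) set \<Rightarrow> 'a filter \<Rightarrow> 'a set" where
  "lim_of \<xi> F = {x. (x, F) \<in> \<xi>}"

definition convergence_on :: "'a set \<Rightarrow> ('a \<times> 'a filter) set \<Rightarrow> bool" where
  "convergence_on X \<xi> \<longleftrightarrow>
     \<xi> \<subseteq> X \<times> proper_filters_on X \<and>
     (\<forall>x \<in> X. x \<in> lim_of \<xi> (principal {x})) \<and>
     (\<forall>F \<in> proper_filters_on X. \<forall>G \<in> proper_filters_on X.
        G \<le> F \<longrightarrow> lim_of \<xi> F \<subseteq> lim_of \<xi> G)"

definition adh :: "'a set \<Rightarrow> ('a \<times> 'a filter) set \<Rightarrow> 'a filter \<Rightarrow> 'a set" where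
  "adh X \<xi> H = (\<Union>G \<in> {G \<in> proper_filters_on X. G \<le> H}. lim_of \<xi> G)"

definition A_op :: "'a filter_class \<Rightarrow> 'a set \<Rightarrow> ('a \<times> 'a filter) set \<Rightarrow> ('a \<times> 'a filter) set" where
  "A_op \<D> X \<xi> = {(x, F). x \<in> X \<and> F \<in> proper_filters_on X \<and>
     x \<in> (\<Inter>D \<in> {D \<in> \<D> X. mesh (members X D) (members X F)}. adh X \<xi> D)}"


text \<open>
  Inclusion of families is the reversed library order, and \<open>members X\<close> identifies \<open>filters_on X\<close>
  with the families of subsets of \<open>X\<close> that are filters in the set-theoretic sense.
\<close>

lemma members_subset_iff:
  assumes "F \<in> filters_on X"
  shows "members X F \<subseteq> members X G \<longleftrightarrow> G \<le> F"
proof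
  assume "G \<le> F"
  then show "members X F \<subseteq> members X G"
    by (auto simp: members_def le_filter_def)
next
  assume sub: "members X F \<subseteq> members X G"
  show "G \<le> F"
    unfolding le_filter_def
  proof (intro allI impI)
    fix P assume P: "eventually P F"
    have "eventually (\<lambda>x. x \<in> X) F"
      using assms by (simp add: filters_on_def le_principal)
    with P have "eventually (\<lambda>x. x \<in> {x \<in> X. P x}) F"
      by eventually_elim simp
    then have "{x \<in> X. P x} \<in> members X G"
      by (intro subsetD[OF sub]) (simp add: members_def Collect_restrict)
    then have "eventually (\<lambda>x. x \<in> X \<and> P x) G"
      by (simp add: members_def)
    then show "eventually P G"
      by (rule eventually_mono) simp
  qed
qed

lemma bij_betw_members:
  "bij_betw (members X) (filters_on X)
     {\<F>. \<F> \<subseteq> Pow X \<and> X \<in> \<F> \<and> (\<forall>A \<in> \<F>. \<forall>B \<in> \<F>. A \<inter> B \<in> \<F>) \<and>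
          (\<forall>A \<in> \<F>. \<forall>B. A \<subseteq> B \<and> B \<subseteq> X \<longrightarrow> B \<in> \<F>)}"
    (is "bij_betw _ _ ?S")
proof (rule bij_betw_imageI)
  show "inj_on (members X) (filters_on X)"
    by (rule inj_onI) (metis members_subset_iff order_antisym order_refl)
  show "members X ` filters_on X = ?S"
  proof (intro equalityI subsetI)
    fix \<F> assume "\<F> \<in> members X ` filters_on X"
    then show "\<F> \<in> ?S"
      by (auto simp: members_def filters_on_def le_principal eventually_conj elim: eventually_mono)
  next
    fix \<F> assume \<F>: "\<F> \<in> ?S"
    define F where "F = Abs_filter (\<lambda>P. {x \<in> X. P x} \<in> \<F>)"
    have Int: "A \<inter> B \<in> \<F>" if "A \<in> \<F>" "B \<in> \<F>" for A B
      using \<F> that by blast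
    have up: "B \<in> \<F>" if "A \<in> \<F>" "A \<subseteq> B" "B \<subseteq> X" for A B
      using \<F> that by blast
    have ev: "eventually P F \<longleftrightarrow> {x \<in> X. P x} \<in> \<F>" for P
      unfolding F_def
    proof (rule eventually_Abs_filter, rule is_filter.intro)
      show "{x \<in> X. True} \<in> \<F>" using \<F> by simp
    next
      fix P Q assume "{x \<in> X. P x} \<in> \<F>" "{x \<in> X. Q x} \<in> \<F>"
      then show "{x \<in> X. P x \<and> Q x} \<in> \<F>"
        by (rule up[OF Int]) auto
    next
      fix P Q assume "\<forall>x. P x \<longrightarrow> Q x" "{x \<in> X. P x} \<in> \<F>"
      then show "{x \<in> X. Q x} \<in> \<F>"
        by (blast intro: up)
    qed
    have "F \<in> filters_on X"
      using \<F> by (simp add: filters_on_def le_principal ev)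
    moreover have "members X F = \<F>"
    proof -
      have "{x \<in> X. x \<in> A} = A" if "A \<subseteq> X" for A using that by blast
      then show ?thesis using \<F> by (auto simp: members_def ev)
    qed
    ultimately show "\<F> \<in> members X ` filters_on X" by blast
  qed
qed

lemma members_image_filter:
  assumes "F \<in> filters_on X"
  shows "members Y (image_filter X R F) = {B. B \<subseteq> Y \<and> (\<exists>A \<in> members X F. R `` A \<subseteq> B)}"
proof -
  have ne: "members X F \<noteq> {}"
    using assms by (auto simp: members_def filters_on_def le_principal)
  have dir: "\<exists>C \<in> members X F. principal (R `` C) \<le> inf (principal (R `` A)) (principal (R `` B))"
    if "A \<in> members X F" "B \<in> members X F" for A B
  proof (rule bexI[of _ "A \<inter> B"])
    show "A \<inter> B \<in> members X F"
      using that by (auto simp: members_def eventually_conj)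
    show "principal (R `` (A \<inter> B)) \<le> inf (principal (R `` A)) (principal (R `` B))"
      by (simp add: Image_mono)
  qed
  have "eventually P (image_filter X R F) \<longleftrightarrow> (\<exists>A \<in> members X F. \<forall>y \<in> R `` A. P y)" for P
    unfolding image_filter_def by (simp add: eventually_INF_base[OF ne dir] eventually_principal)
  then show ?thesis
    by (simp add: members_def[of Y] subset_eq)
qed

lemma convergence_on_A_op:
  assumes "\<And>X. \<D> X \<subseteq> filters_on X" and \<xi>: "convergence_on X \<xi>"
  shows "convergence_on X (A_op \<D> X \<xi>)"
  unfolding convergence_on_def
proof (intro conjI ballI impI)
  show "A_op \<D> X \<xi> \<subseteq> X \<times> proper_filters_on X"
    by (auto simp: A_op_def)
next
  fix x assume x: "x \<in> X"
  have pr: "principal {x} \<in> proper_filters_on X"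
    using x by (simp add: proper_filters_on_def filters_on_def principal_eq_bot_iff)
  have "x \<in> adh X \<xi> D"
    if D: "D \<in> \<D> X" and m: "mesh (members X D) (members X (principal {x}))" for D
  proof -
    have "{x} \<in> members X (principal {x})"
      using x by (simp add: members_def eventually_principal)
    then have "\<forall>A \<in> members X D. A \<inter> {x} \<noteq> {}"
      using m unfolding mesh_def by blast
    then have "members X D \<subseteq> members X (principal {x})"
      by (auto simp: members_def eventually_principal)
    then have "principal {x} \<le> D"
      using members_subset_iff D assms(1) by blast
    then show ?thesis
      using pr \<xi> x by (auto simp: adh_def convergence_on_def)
  qed
  then show "x \<in> lim_of (A_op \<D> X \<xi>) (principal {x})"
    using x pr by (auto simp: lim_of_def A_op_def)
next
  fix F G assume FG: "F \<in> proper_filters_on X" "G \<in> proper_filters_on X" "G \<le> F"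
  then have "members X F \<subseteq> members X G"
    by (simp add: members_subset_iff proper_filters_on_def)
  then have "mesh (members X D) (members X F)" if "mesh (members X D) (members X G)" for D
    using that unfolding mesh_def by blast
  then show "lim_of (A_op \<D> X \<xi>) F \<subseteq> lim_of (A_op \<D> X \<xi>) G"
    using FG by (auto simp: lim_of_def A_op_def)
qed

end

theory Submission
  imports Defs
begin

text \<open>
  Both sides of the equivalence say that each class interpolates the other at ultrafilters:
  whenever \<open>D\<close> belongs to one class and an ultrafilter \<open>U\<close> is finer than \<open>D\<close>, some \<open>H\<close> of
  the other class lies between \<open>D\<close> and \<open>U\<close>. The two directions are proved as inclusions,
  between \<open>hat \<D>\<close> and \<open>hat \<H>\<close> and between the two adherence operators, and the theorem
  follows by exchanging the classes.

  From hats to operators (\<open>A_op_mono\<close>): if \<open>D\<close> meshes with \<open>F\<close>, then some ultrafilter is finer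
  than both. An interpolated \<open>H\<close> still meshes with \<open>F\<close>, and its adherence is contained in that
  of \<open>D\<close>, so the conditions imposed by \<open>\<H>\<close> imply those imposed by \<open>\<D>\<close>.

  From operators to hats (\<open>ex_between_if_A_op_le\<close>): given \<open>D\<close>, choose a point \<open>x\<^sub>0\<close> off the kernel
  of \<open>D\<close> and let \<open>x\<^sub>0\<close> be a limit of exactly the filters that do not mesh with \<open>D\<close>, all other
  points being isolated. In this convergence \<open>x\<^sub>0\<close> is adherent to a filter \<open>H\<close> precisely when \<open>H\<close>
  is not finer than \<open>D\<close>. So \<open>D\<close> prevents a finer ultrafilter \<open>U\<close> from converging to \<open>x\<^sub>0\<close> under
  the operator of \<open>\<D>\<close>; if the operator of \<open>\<H>\<close> prevents it too, the filter \<open>H\<close> responsible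
  meshes with \<open>U\<close>, hence is coarser than \<open>U\<close>, and is finer than \<open>D\<close>. A point off the kernel
  exists unless \<open>D\<close> is the principal filter of the whole set, which every class considered
  contains.
\<close>

section \<open>Meshing and ultrafilters\<close>

lemma mesh_members_iff_inf_ne_bot:
  assumes F: "F \<in> filters_on X" and G: "G \<in> filters_on X"
  shows "mesh (members X F) (members X G) \<longleftrightarrow> inf F G \<noteq> bot"
proof
  assume m: "mesh (members X F) (members X G)"
  show "inf F G \<noteq> bot"
  proof
    assume "inf F G = bot"
    then obtain P Q where PQ: "eventually P F" "eventually Q G" "\<And>x. P x \<Longrightarrow> Q x \<Longrightarrow> False"
      unfolding trivial_limit_def eventually_inf by blast
    have "eventually (\<lambda>x. x \<in> X) F" "eventually (\<lambda>x. x \<in> X) G"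
      using F G by (simp_all add: filters_on_def le_principal)
    then have "{x \<in> X. P x} \<in> members X F" "{x \<in> X. Q x} \<in> members X G"
      using PQ by (auto simp: members_def eventually_conj)
    then have "{x \<in> X. P x} \<inter> {x \<in> X. Q x} \<noteq> {}"
      using m unfolding mesh_def by blast
    then show False using PQ(3) by blast
  qed
next
  assume ne: "inf F G \<noteq> bot"
  show "mesh (members X F) (members X G)"
    unfolding mesh_def
  proof (intro ballI notI)
    fix A B assume AB: "A \<in> members X F" "B \<in> members X G" "A \<inter> B = {}"
    then have "eventually (\<lambda>x. False) (inf F G)"
      unfolding eventually_inf members_def by blast
    then show False using ne by (simp add: trivial_limit_def)
  qed
qed

lemma filters_on_mono: "F \<in> filters_on X \<Longrightarrow> G \<le> F \<Longrightarrow> G \<in> filters_on X"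
  by (auto simp: filters_on_def)

text \<open>Zorn's lemma applies because the infimum of a nonempty chain of filters is its union as a family of
  sets, so it omits the empty set if all members of the chain do.\<close>

lemma ex_ultrafilter_finer:
  assumes F: "F \<in> proper_filters_on X"
  obtains U where "U \<in> ultrafilters_finer X F"
proof -
  define S where "S = {G. G \<le> F \<and> G \<noteq> bot}"
  let ?r = "relation_of (\<lambda>G H. H \<le> G) S"
  have "\<exists>U\<in>S. \<forall>G\<in>S. G \<le> U \<longrightarrow> G = U"
  proof (rule predicate_Zorn)
    show "partial_order_on S ?r"
      by (rule partial_order_on_relation_ofI) auto
  next
    fix C assume C: "C \<in> Chains ?r"
    have CS: "C \<subseteq> S" and chain: "\<And>G H. G \<in> C \<Longrightarrow> H \<in> C \<Longrightarrow> G \<le> H \<or> H \<le> G"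
      using C unfolding Chains_def relation_of_def by auto
    show "\<exists>L\<in>S. \<forall>G\<in>C. L \<le> G"
    proof (cases "C = {}")
      case True
      then show ?thesis using F by (auto simp: S_def proper_filters_on_def)
    next
      case False
      have "\<exists>K\<in>C. K \<le> inf G H" if "G \<in> C" "H \<in> C" for G H
        using chain[OF that] that by (metis inf.absorb1 inf.absorb2 order_refl)
      then have "eventually (\<lambda>x. False) (Inf C) \<longleftrightarrow> (\<exists>G\<in>C. eventually (\<lambda>x. False) G)"
        by (rule eventually_Inf_base[OF False])
      then have "Inf C \<noteq> bot"
        using CS by (auto simp: trivial_limit_def S_def)
      moreover have "Inf C \<le> F"
        using False CS by (auto simp: S_def intro: Inf_lower2)
      ultimately show ?thesis
        by (intro bexI[of _ "Inf C"]) (auto simp: S_def intro: Inf_lower)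
    qed
  qed
  then obtain U where U: "U \<in> S" "\<And>G. G \<in> S \<Longrightarrow> G \<le> U \<Longrightarrow> G = U" by blast
  have "U \<in> ultrafilters_finer X F"
    using U F filters_on_mono[of F X U]
    by (auto simp: ultrafilters_finer_def ultrafilters_on_def proper_filters_on_def S_def)
  then show thesis by (rule that)
qed

lemma ultrafilter_le_if_inf_ne_bot:
  assumes U: "U \<in> ultrafilters_on X" and ne: "inf F U \<noteq> bot"
  shows "U \<le> F"
proof -
  have "inf F U \<in> proper_filters_on X"
    using U ne filters_on_mono[of U X "inf F U"]
    by (auto simp: ultrafilters_on_def proper_filters_on_def)
  then have "inf F U = U"
    using U by (simp add: ultrafilters_on_def)
  then show ?thesis by (metis inf_le1)
qed

section \<open>From hats to adherence operators\<close>

lemma mem_hat_if_mem: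
  assumes "D \<in> \<D> X" and "D \<in> proper_filters_on X"
  shows "D \<in> hat \<D> X"
  using assms by (auto simp: hat_def ultrafilters_finer_def)

lemma adh_mono: "H \<le> D \<Longrightarrow> adh X \<xi> H \<subseteq> adh X \<xi> D"
  unfolding adh_def by (force intro: order_trans)

lemma A_op_mono:
  assumes \<D>: "\<D> X \<subseteq> filters_on X" and \<H>: "\<H> X \<subseteq> filters_on X"
    and hat: "hat \<D> X \<subseteq> hat \<H> X"
  shows "A_op \<H> X \<xi> \<subseteq> A_op \<D> X \<xi>"
proof -
  have "x \<in> adh X \<xi> D"
    if xF: "(x, F) \<in> A_op \<H> X \<xi>" and D: "D \<in> \<D> X" and DF: "mesh (members X D) (members X F)"
    for x F D
  proof -
    have F: "F \<in> filters_on X" and lim: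
      "\<And>H. H \<in> \<H> X \<Longrightarrow> mesh (members X H) (members X F) \<Longrightarrow> x \<in> adh X \<xi> H"
      using xF by (auto simp: A_op_def proper_filters_on_def)
    have D': "D \<in> filters_on X" using D \<D> by blast
    have ne: "inf D F \<noteq> bot"
      using DF mesh_members_iff_inf_ne_bot[OF D' F] by simp
    then have "inf D F \<in> proper_filters_on X"
      using D' filters_on_mono[of D X "inf D F"] by (simp add: proper_filters_on_def)
    then obtain U where "U \<in> ultrafilters_finer X (inf D F)"
      by (rule ex_ultrafilter_finer)
    then have U: "U \<in> ultrafilters_finer X D" "U \<le> F" "U \<noteq> bot"
      by (auto simp: ultrafilters_finer_def ultrafilters_on_def proper_filters_on_def)
    have "D \<in> proper_filters_on X"
      using D' ne by (auto simp: proper_filters_on_def)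
    then have "D \<in> hat \<H> X"
      using mem_hat_if_mem[where \<D> = \<D>, OF D] hat by blast
    then obtain H where H: "H \<in> \<H> X" "U \<le> H" "H \<le> D"
      using U(1) unfolding hat_def by blast
    have "inf H F \<noteq> bot"
      using H(2) U(2,3) by (metis bot.extremum_uniqueI le_inf_iff)
    then have "mesh (members X H) (members X F)"
      using H(1) \<H> F mesh_members_iff_inf_ne_bot by blast
    then show ?thesis
      using lim[OF H(1)] adh_mono[OF H(3)] by blast
  qed
  then show ?thesis
    by (auto simp: A_op_def)
qed

section \<open>From adherence operators to hats\<close>

text \<open>The pairs \<open>(x, principal {x})\<close> alone form the discrete convergence.\<close>

definition repelling :: "'a set \<Rightarrow> 'a \<Rightarrow> 'a filter \<Rightarrow> ('a \<times> 'a filter) set" where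
  "repelling X x\<^sub>0 D = {(x, principal {x}) | x. x \<in> X} \<union>
     {x\<^sub>0} \<times> {G \<in> proper_filters_on X. inf G D = bot}"

lemma le_principal_singleton_iff:
  assumes "G \<noteq> bot"
  shows "G \<le> principal {x} \<longleftrightarrow> G = principal {x}"
proof
  assume le: "G \<le> principal {x}"
  have "eventually P G \<longleftrightarrow> P x" for P
  proof
    assume "eventually P G"
    with le have "eventually (\<lambda>y. P y \<and> y \<in> {x}) G"
      by (simp add: le_principal eventually_conj)
    then show "P x" using assms eventually_happens[of _ G] by fastforce
  next
    assume "P x"
    with le show "eventually P G"
      by (auto simp: le_principal elim: eventually_mono)
  qed
  then show "G = principal {x}" by (simp add: filter_eq_iff eventually_principal)
qed simp

lemma principal_singleton_proper: "x \<in> X \<Longrightarrow> principal {x} \<in> proper_filters_on X"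
  by (simp add: proper_filters_on_def filters_on_def principal_eq_bot_iff)

lemma convergence_on_repelling:
  assumes "x\<^sub>0 \<in> X"
  shows "convergence_on X (repelling X x\<^sub>0 D)"
  unfolding convergence_on_def
proof (intro conjI ballI impI)
  show "repelling X x\<^sub>0 D \<subseteq> X \<times> proper_filters_on X"
    using assms principal_singleton_proper by (auto simp: repelling_def)
next
  fix x assume "x \<in> X"
  then show "x \<in> lim_of (repelling X x\<^sub>0 D) (principal {x})"
    by (auto simp: lim_of_def repelling_def)
next
  fix F G assume FG: "F \<in> proper_filters_on X" "G \<in> proper_filters_on X" "G \<le> F"
  then have "inf G D = bot" if "inf F D = bot"
    using that by (metis bot.extremum_uniqueI inf_mono order_refl)
  moreover have "G = principal {x}" if "F = principal {x}" for x
    using FG that le_principal_singleton_iff[of G x] by (simp add: proper_filters_on_def)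
  ultimately show "lim_of (repelling X x\<^sub>0 D) F \<subseteq> lim_of (repelling X x\<^sub>0 D) G"
    using FG by (auto simp: lim_of_def repelling_def)
qed

text \<open>If \<open>H\<close> is not finer than \<open>D\<close>, some \<open>A\<close> in \<open>D\<close> is not in \<open>H\<close>; the trace of \<open>H\<close> on the
  complement of \<open>A\<close> is then a proper filter that does not mesh with \<open>D\<close>, and so converges
  to \<open>x\<^sub>0\<close>.\<close>

lemma adh_repelling_iff:
  assumes x0: "\<not> principal {x\<^sub>0} \<le> D" and H: "H \<in> filters_on X"
  shows "x\<^sub>0 \<in> adh X (repelling X x\<^sub>0 D) H \<longleftrightarrow> \<not> H \<le> D"
proof
  assume "x\<^sub>0 \<in> adh X (repelling X x\<^sub>0 D) H"
  then obtain G where G: "G \<in> proper_filters_on X" "G \<le> H"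
    and lim: "G = principal {x\<^sub>0} \<or> inf G D = bot"
    by (auto simp: adh_def lim_of_def repelling_def)
  show "\<not> H \<le> D"
  proof
    assume "H \<le> D"
    with G(2) have "G \<le> D" by simp
    with lim x0 have "G = bot" by (auto simp: inf.absorb1)
    with G(1) show False by (simp add: proper_filters_on_def)
  qed
next
  assume "\<not> H \<le> D"
  then obtain P where P: "eventually P D" "\<not> eventually P H"
    unfolding le_filter_def by blast
  define G where "G = inf H (principal {x. \<not> P x})"
  have "G \<noteq> bot"
    using P(2) by (simp add: G_def trivial_limit_def eventually_inf_principal)
  then have "G \<in> proper_filters_on X"
    using H filters_on_mono[of H X G] by (simp add: G_def proper_filters_on_def)
  moreover have "inf G D = bot"
  proof -
    have "eventually (\<lambda>x. \<not> P x) G"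
      by (simp add: G_def eventually_inf_principal)
    with P(1) show ?thesis
      unfolding trivial_limit_def eventually_inf by blast
  qed
  moreover have "G \<le> H" by (simp add: G_def)
  ultimately show "x\<^sub>0 \<in> adh X (repelling X x\<^sub>0 D) H"
    by (auto simp: adh_def lim_of_def repelling_def)
qed

lemma ex_between_if_A_op_le:
  assumes \<D>: "\<D> X \<subseteq> filters_on X" and \<H>: "\<H> X \<subseteq> filters_on X"
    and top: "principal X \<in> \<H> X"
    and le: "\<And>\<xi>. convergence_on X \<xi> \<Longrightarrow> A_op \<H> X \<xi> \<subseteq> A_op \<D> X \<xi>"
    and D: "D \<in> \<D> X" and U: "U \<in> ultrafilters_on X" "U \<le> D"
  shows "\<exists>H \<in> \<H> X. U \<le> H \<and> H \<le> D"
proof (cases "\<forall>x\<in>X. principal {x} \<le> D")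
  case True
  then have "principal X \<le> D"
    by (auto simp: le_filter_def eventually_principal)
  moreover have "D \<le> principal X"
    using D \<D> by (auto simp: filters_on_def)
  ultimately show ?thesis using U(2) top by (metis order_antisym order_refl)
next
  case False
  then obtain x\<^sub>0 where x0: "x\<^sub>0 \<in> X" "\<not> principal {x\<^sub>0} \<le> D" by blast
  let ?\<xi> = "repelling X x\<^sub>0 D"
  have D': "D \<in> filters_on X" using D \<D> by blast
  have U': "U \<in> proper_filters_on X" "U \<in> filters_on X" "U \<noteq> bot"
    using U(1) by (auto simp: ultrafilters_on_def proper_filters_on_def)
  have "mesh (members X D) (members X U)"
    using mesh_members_iff_inf_ne_bot[OF D' U'(2)] U(2) U'(3) by (simp add: inf.absorb2)
  moreover have "x\<^sub>0 \<notin> adh X ?\<xi> D"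
    using adh_repelling_iff[OF x0(2) D'] by simp
  ultimately have "(x\<^sub>0, U) \<notin> A_op \<D> X ?\<xi>"
    using D by (auto simp: A_op_def)
  then have "(x\<^sub>0, U) \<notin> A_op \<H> X ?\<xi>"
    using le[OF convergence_on_repelling[OF x0(1)]] by blast
  then obtain H where H: "H \<in> \<H> X" "mesh (members X H) (members X U)" "x\<^sub>0 \<notin> adh X ?\<xi> H"
    using x0(1) U'(1) by (auto simp: A_op_def)
  have H': "H \<in> filters_on X" using H(1) \<H> by blast
  have "U \<le> H"
    using H(2) mesh_members_iff_inf_ne_bot[OF H' U'(2)] ultrafilter_le_if_inf_ne_bot[OF U(1)]
    by blast
  moreover have "H \<le> D"
    using H(3) adh_repelling_iff[OF x0(2) H'] by blast
  ultimately show ?thesis using H(1) by blast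
qed

lemma hat_mono_if_A_op_le:
  assumes "\<D> X \<subseteq> filters_on X" and "\<H> X \<subseteq> filters_on X"
    and "principal X \<in> \<H> X"
    and "\<And>\<xi>. convergence_on X \<xi> \<Longrightarrow> A_op \<H> X \<xi> \<subseteq> A_op \<D> X \<xi>"
  shows "hat \<D> X \<subseteq> hat \<H> X"
proof
  fix F assume F: "F \<in> hat \<D> X"
  have "\<exists>H \<in> \<H> X. U \<le> H \<and> H \<le> F" if U: "U \<in> ultrafilters_finer X F" for U
  proof -
    obtain D where D: "D \<in> \<D> X" "U \<le> D" "D \<le> F"
      using F U unfolding hat_def by blast
    then obtain H where "H \<in> \<H> X" "U \<le> H" "H \<le> D"
      using ex_between_if_A_op_le[where \<D> = \<D> and \<H> = \<H>, OF assms D(1) _ D(2)] U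
      by (auto simp: ultrafilters_finer_def)
    then show ?thesis using D(3) order_trans by blast
  qed
  then show "F \<in> hat \<H> X"
    using F by (simp add: hat_def)
qed

section \<open>The equivalence\<close>

theorem corollary3:
  fixes \<D> \<H> :: "'a filter_class"
  assumes "F0_composable \<D>" and "F0_composable \<H>"
  shows "(\<forall>X \<xi>. convergence_on X \<xi> \<longrightarrow> A_op \<D> X \<xi> = A_op \<H> X \<xi>) \<longleftrightarrow>
         (\<forall>X. hat \<H> X = hat \<D> X)"
proof -
  have \<D>: "\<D> X \<subseteq> filters_on X" "principal X \<in> \<D> X" for X
    using assms(1) by (simp_all add: F0_composable_def)
  have \<H>: "\<H> X \<subseteq> filters_on X" "principal X \<in> \<H> X" for X
    using assms(2) by (simp_all add: F0_composable_def)
  show ?thesis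
  proof (intro iffI allI impI)
    fix X assume eq: "\<forall>X \<xi>. convergence_on X \<xi> \<longrightarrow> A_op \<D> X \<xi> = A_op \<H> X \<xi>"
    show "hat \<H> X = hat \<D> X"
    proof
      show "hat \<H> X \<subseteq> hat \<D> X"
        using \<D> \<H> eq by (intro hat_mono_if_A_op_le) simp_all
      show "hat \<D> X \<subseteq> hat \<H> X"
        using \<D> \<H> eq by (intro hat_mono_if_A_op_le) simp_all
    qed
  next
    fix X and \<xi> :: "('a \<times> 'a filter) set"
    assume eq: "\<forall>X. hat \<H> X = hat \<D> X"
    show "A_op \<D> X \<xi> = A_op \<H> X \<xi>"
    proof
      show "A_op \<D> X \<xi> \<subseteq> A_op \<H> X \<xi>"
        using \<D> \<H> eq by (intro A_op_mono) simp_all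
      show "A_op \<H> X \<xi> \<subseteq> A_op \<D> X \<xi>"
        using \<D> \<H> eq by (intro A_op_mono) simp_all
    qed
  qed
qed

end
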